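(* Let $k$, $n$ and $s$ be positive integers and let $x_1,\ldots,x_n$ be independent variables; write $E_j^{(s)}=E_j^{(s)}(x_1,\ldots,x_n)$, $H_j^{(s)}=H_j^{(s)}(x_1,\ldots,x_n)$, $P_j^{(s)}=P_j^{(s)}(x_1,\ldots,x_n)$. Then \begin{enumerate} \item $kE_k^{(s)}=\sum_{j=1}^k(-1)^{j-1}P_j^{(s)}E_{k-j}^{(s)}$; \item $kH_k^{(s)}=\sum_{j=1}^k P_j^{(s)}H_{k-j}^{(s)}$; \item $P_k^{(s)}=\sum_{j=1}^k(-1)^{j-1}j\,E_j^{(s)}H_{k-j}^{(s)}$. \end{enumerate}
   Context: For a positive integer $s$, $H_k^{(s)}$ and $E_k^{(s)}$ ($k\ge0$) are defined by the formal power series identities $$\sum_{k\ge0}H_k^{(s)}(x_1,\ldots,x_n)t^k=\prod_{i=1}^n\big(1-x_it+\cdots+(-x_it)^s\big)^{-1},\qquad \sum_{k\ge0}E_k^{(s)}(x_1,\ldots,x_n)t^k=\prod_{i=1}^n\big(1+x_it+\cdots+(x_it)^s\big).$$ $p_k(x_1,\ldots,x_n)=\sum_{i=1}^n x_i^k$ is the power sum symmetric function, and $P_k^{(s)}(x_1,\ldots,x_n)=c_k^{(s)}p_k(x_1,\ldots,x_n)$ where $c_k^{(s)}=(-1)^k s$ if $k\equiv0\pmod{s+1}$ and $c_k^{(s)}=(-1)^{k-1}$ otherwise. *)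

theory Defs
  imports "HOL-Computational_Algebra.Formal_Power_Series" "HOL-Library.Poly_Mapping"
begin

text \<open>Polynomials in independent variables indexed by \<open>nat\<close> with coefficients in \<open>'r\<close>:
  finitely supported maps from exponent vectors to coefficients.\<close>

type_synonym 'r mpoly = "(nat \<Rightarrow>\<^sub>0 nat) \<Rightarrow>\<^sub>0 'r"

definition indet :: "nat \<Rightarrow> 'r::comm_ring_1 mpoly"
  where "indet i = Poly_Mapping.single (Poly_Mapping.single i 1) 1"

text \<open>In the following, \<open>x 1, \<dots>, x n\<close> are elements of a commutative ring and the
  power series variable \<open>t\<close> is \<open>fps_X\<close>.\<close>

definition E_series :: "nat \<Rightarrow> nat \<Rightarrow> (nat \<Rightarrow> 'a::comm_ring_1) \<Rightarrow> 'a fps"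
  where "E_series s n x = (\<Prod>i=1..n. \<Sum>j=0..s. (fps_const (x i) * fps_X) ^ j)"

text \<open>The coefficient ring need not be a field, so the class operation \<open>inverse\<close> on power series
  is not available. Each factor has constant coefficient \<open>1\<close>, and \<open>fps_right_inverse f 1\<close> is the
  inverse of such a series, see lemma \<open>H_factor_inverse\<close>.\<close>

definition H_factor :: "nat \<Rightarrow> 'a::comm_ring_1 \<Rightarrow> 'a fps"
  where "H_factor s a = (\<Sum>j=0..s. (- (fps_const a * fps_X)) ^ j)"

definition H_series :: "nat \<Rightarrow> nat \<Rightarrow> (nat \<Rightarrow> 'a::comm_ring_1) \<Rightarrow> 'a fps"
  where "H_series s n x = (\<Prod>i=1..n. fps_right_inverse (H_factor s (x i)) 1)"

lemma H_factor_inverse: "H_factor s a * fps_right_inverse (H_factor s a) 1 = 1"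
proof (rule fps_right_inverse)
  have "fps_nth (H_factor s a) 0 = (\<Sum>j=0..s. if j = 0 then 1 else 0)"
    unfolding H_factor_def fps_sum_nth
    by (intro sum.cong) (auto simp: fps_nth_power_0 power_0_left)
  then show "fps_nth (H_factor s a) 0 * 1 = 1"
    by simp
qed

definition modE :: "nat \<Rightarrow> nat \<Rightarrow> (nat \<Rightarrow> 'a::comm_ring_1) \<Rightarrow> nat \<Rightarrow> 'a"
  where "modE s n x k = fps_nth (E_series s n x) k"

definition modH :: "nat \<Rightarrow> nat \<Rightarrow> (nat \<Rightarrow> 'a::comm_ring_1) \<Rightarrow> nat \<Rightarrow> 'a"
  where "modH s n x k = fps_nth (H_series s n x) k"

definition power_sum :: "nat \<Rightarrow> (nat \<Rightarrow> 'a::comm_ring_1) \<Rightarrow> nat \<Rightarrow> 'a"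
  where "power_sum n x k = (\<Sum>i=1..n. x i ^ k)"

definition c_coeff :: "nat \<Rightarrow> nat \<Rightarrow> int"
  where "c_coeff s k = (if k mod (s + 1) = 0 then (- 1) ^ k * int s else (- 1) ^ (k - 1))"

definition modP :: "nat \<Rightarrow> nat \<Rightarrow> (nat \<Rightarrow> 'a::comm_ring_1) \<Rightarrow> nat \<Rightarrow> 'a"
  where "modP s n x k = of_int (c_coeff s k) * power_sum n x k"

end

theory Submission
  imports Defs
begin

text \<open>With \<open>D f = t f'\<close>, the truncated geometric series \<open>g = 1 + b t + \<dots> + (b t)\<^sup>s\<close> satisfies
  \<open>D g = R g\<close>, where \<open>R\<close> has coefficients \<open>b\<^sup>k\<close> for \<open>k \<ge> 1\<close>, except for \<open>- s b\<^sup>k\<close> if \<open>s + 1\<close> divides \<open>k\<close>: the sum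
  of these weights over \<open>s + 1\<close> consecutive indices vanishes. As \<open>D\<close> is a derivation, logarithmic
  derivatives add under products and change sign under inversion. Taking \<open>b = x\<^sub>i\<close> and \<open>b = - x\<^sub>i\<close>
  gives the first two identities, and the third one is \<open>- (D F) / F = P\<close> for \<open>F(t) = E(-t) = 1 / H(t)\<close>.\<close>

text \<open>Here \<open>r\<close> stands for t f'/f. The relation is stated without division because
  the coefficients form only a commutative ring.\<close>

definition fps_log_XD :: "'a::comm_ring_1 fps \<Rightarrow> 'a fps \<Rightarrow> bool"
  where "fps_log_XD f r \<longleftrightarrow> fps_X * fps_deriv f = r * f"

lemma fps_log_XD_mult:
  assumes "fps_log_XD f r" "fps_log_XD g q"
  shows "fps_log_XD (f * g) (r + q)"
proof -
  have "fps_X * fps_deriv (f * g) = (fps_X * fps_deriv f) * g + f * (fps_X * fps_deriv g)"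
    by (simp add: algebra_simps)
  also have "\<dots> = (r + q) * (f * g)"
    using assms by (simp add: fps_log_XD_def algebra_simps)
  finally show ?thesis by (simp add: fps_log_XD_def)
qed

lemma fps_log_XD_prod:
  assumes "\<And>i. i \<in> A \<Longrightarrow> fps_log_XD (f i) (r i)"
  shows "fps_log_XD (\<Prod>i\<in>A. f i) (\<Sum>i\<in>A. r i)"
  using assms
proof (induction A rule: infinite_finite_induct)
  case (insert i A)
  then show ?case by (simp add: fps_log_XD_mult)
qed (simp_all add: fps_log_XD_def)

lemma fps_log_XD_inverse:
  assumes f: "fps_log_XD f r" and fg: "f * g = 1"
  shows "fps_log_XD g (- r)"
proof -
  have "fps_deriv (f * g) = 0" by (simp add: fg)
  \<comment> \<open>The extra factor \<open>g\<close> completes each \<open>f\<close> to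
    \<open>f * g\<close>, which is 1; this replaces cancelling \<open>f\<close>.\<close>
  then have "0 = g * (fps_X * fps_deriv (f * g))" by simp
  also have "\<dots> = (fps_X * fps_deriv f) * g * g + (f * g) * (fps_X * fps_deriv g)"
    by (simp add: algebra_simps)
  also have "\<dots> = r * g * (f * g) + (f * g) * (fps_X * fps_deriv g)"
    using f by (simp add: fps_log_XD_def algebra_simps)
  finally have "r * g + fps_X * fps_deriv g = 0"
    by (simp add: fg)
  then show ?thesis
    by (simp add: fps_log_XD_def add_eq_0_iff)
qed

lemma fps_nth_X_mult_deriv:
  "fps_nth (fps_X * fps_deriv f) k = of_nat k * fps_nth (f :: 'a::comm_ring_1 fps) k"
  by (cases k) auto

text \<open>Compare coefficients of t^k in t f' = r f. As \<open>r\<close> has no constant term, the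
  summand j = 0 drops out and only earlier coefficients of \<open>f\<close> remain on the
  right.\<close>

lemma fps_log_XD_nth:
  assumes "fps_log_XD f r" "fps_nth r 0 = 0"
  shows "of_nat k * fps_nth f k = (\<Sum>j=1..k. fps_nth r j * fps_nth f (k - j))"
proof -
  have "of_nat k * fps_nth f k = fps_nth (r * f) k"
    using assms(1) by (metis fps_log_XD_def fps_nth_X_mult_deriv)
  also have "\<dots> = (\<Sum>j=1..k. fps_nth r j * fps_nth f (k - j))"
    by (simp add: fps_mult_nth sum.atLeast_Suc_atMost assms(2))
  finally show ?thesis .
qed

text \<open>For k \<ge> 1 these are the coefficients of t/(1-t) - (s+1) t^(s+1)/(1-t^(s+1)), the
  logarithmic derivative, times t, of (1-t^(s+1))/(1-t).\<close>

definition geom_weight :: "nat \<Rightarrow> nat \<Rightarrow> int"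
  where "geom_weight s k = (if (s + 1) dvd k then - int s else 1)"

lemma c_coeff_eq_geom_weight:
  assumes "k \<ge> 1"
  shows "c_coeff s k = (- 1) ^ (k - 1) * geom_weight s k"
  using assms by (cases k) (auto simp: c_coeff_def geom_weight_def dvd_eq_mod_eq_0)

lemma sum_geom_weight_initial:
  assumes "k \<le> s"
  shows "(\<Sum>j=1..k. geom_weight s j) = int k"
proof -
  have "geom_weight s j = 1" if "j \<in> {1..k}" for j
    using that assms by (auto simp: geom_weight_def dest: dvd_imp_le)
  then show ?thesis by simp
qed

text \<open>Exactly one of s+1 consecutive indices is a multiple of s+1, and its weight -s balances
  the s ones. The induction slides the window by one place.\<close>

lemma sum_geom_weight_period: "(\<Sum>j=m+1..m+s+1. geom_weight s j) = 0"
proof (induction m)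
  case 0
  have "(\<Sum>j=1..s+1. geom_weight s j) = (\<Sum>j=1..s. geom_weight s j) + geom_weight s (s + 1)"
    by simp
  also have "\<dots> = 0"
    by (simp only: sum_geom_weight_initial order_refl) (simp add: geom_weight_def)
  finally show ?case by simp
next
  case (Suc m)
  \<comment> \<open>The index entering the window exceeds the one leaving it by s+1, so both carry
    the same weight.\<close>
  have "(s + 1) dvd (m + s + 2) \<longleftrightarrow> (s + 1) dvd (m + 1)"
    using dvd_add_triv_right_iff[of "s + 1" "m + 1"] by (simp add: numeral_2_eq_2)
  then have "geom_weight s (m + s + 2) = geom_weight s (m + 1)"
    by (simp only: geom_weight_def)
  moreover have "(\<Sum>j=m+1..m+s+2. geom_weight s j)
      = (\<Sum>j=m+1..m+s+1. geom_weight s j) + geom_weight s (m + s + 2)"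
    by (simp add: numeral_2_eq_2)
  moreover have "(\<Sum>j=m+1..m+s+2. geom_weight s j)
      = geom_weight s (m + 1) + (\<Sum>j=m+2..m+s+2. geom_weight s j)"
    by (simp add: sum.atLeast_Suc_atMost)
  ultimately show ?case
    using Suc by (simp add: numeral_2_eq_2)
qed

lemma fps_nth_geom_sum:
  "fps_nth (\<Sum>j=0..s. (fps_const b * fps_X) ^ j) k = (if k \<le> s then b ^ k else (0 :: 'a::comm_ring_1))"
proof -
  have "fps_nth (\<Sum>j=0..s. (fps_const b * fps_X) ^ j) k = (\<Sum>j=0..s. if k = j then b ^ j else 0)"
    by (simp add: fps_sum_nth power_mult_distrib fps_const_power fps_X_power_nth if_distrib
        cong: if_cong)
  then show ?thesis by simp
qed

text \<open>The constant term is set apart because \<open>geom_weight s 0\<close> is -s, whereas a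
  series t g'/g starts at degree 1.\<close>

definition geom_log :: "nat \<Rightarrow> 'a::comm_ring_1 \<Rightarrow> 'a fps"
  where "geom_log s b = Abs_fps (\<lambda>k. if k = 0 then 0 else of_int (geom_weight s k) * b ^ k)"

lemma fps_log_XD_geom_sum:
  "fps_log_XD (\<Sum>j=0..s. (fps_const b * fps_X) ^ j) (geom_log s (b :: 'a::comm_ring_1))"
  unfolding fps_log_XD_def
proof (rule fps_ext)
  fix k
  let ?g = "\<Sum>j=0..s. (fps_const b * fps_X) ^ j"
  \<comment> \<open>The coefficient of \<open>?g\<close> at k-j is nonzero only if k-j \<le> s, so j
    runs over a window ending at k; the powers of \<open>b\<close> combine to b^k.\<close>
  have "fps_nth (geom_log s b * ?g) k
      = (\<Sum>j=0..k. if j \<in> {1..k} \<inter> {j. k \<le> j + s} then of_int (geom_weight s j) * b ^ k else 0)"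
    unfolding fps_mult_nth
    by (intro sum.cong)
      (auto simp: geom_log_def fps_nth_geom_sum mult.assoc simp flip: power_add)
  also have "\<dots> = (\<Sum>j\<in>{1..k} \<inter> {j. k \<le> j + s}. of_int (geom_weight s j) * b ^ k)"
    by (intro sum.mono_neutral_cong_right) auto
  also have "\<dots> = of_int (\<Sum>j\<in>{1..k} \<inter> {j. k \<le> j + s}. geom_weight s j) * b ^ k"
    by (simp add: sum_distrib_right)
  also have "(\<Sum>j\<in>{1..k} \<inter> {j. k \<le> j + s}. geom_weight s j) = (if k \<le> s then int k else 0)"
  \<comment> \<open>For k \<le> s the window is cut off at 1 and holds k ones; for larger k it is a
    full period.\<close>
  proof (cases "k \<le> s")
    case True
    then have "{1..k} \<inter> {j. k \<le> j + s} = {1..k}" by auto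
    with True show ?thesis by (simp only: sum_geom_weight_initial if_True)
  next
    case False
    define m where "m = k - s - 1"
    from False have k: "k = m + s + 1" by (simp add: m_def)
    then have "{1..k} \<inter> {j. k \<le> j + s} = {m+1..m+s+1}" by auto
    with False show ?thesis by (simp only: sum_geom_weight_period if_False)
  qed
  also have "of_int (if k \<le> s then int k else 0) * b ^ k = fps_nth (fps_X * fps_deriv ?g) k"
    by (simp only: fps_nth_X_mult_deriv fps_nth_geom_sum) simp
  finally show "fps_nth (fps_X * fps_deriv ?g) k = fps_nth (geom_log s b * ?g) k" ..
qed

lemma H_factor_eq_geom_sum: "H_factor s a = (\<Sum>j=0..s. (fps_const (- a) * fps_X) ^ j)"
  by (simp add: H_factor_def flip: fps_const_neg)

text \<open>The substitution t -> c t is multiplicative, expressed on coefficients.\<close>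

lemma fps_nth_mult_scaled:
  fixes f g f' g' :: "'a::comm_ring_1 fps"
  assumes "\<And>k. fps_nth f' k = c ^ k * fps_nth f k" "\<And>k. fps_nth g' k = c ^ k * fps_nth g k"
  shows "fps_nth (f' * g') k = c ^ k * fps_nth (f * g) k"
proof -
  have "c ^ j * fps_nth f j * (c ^ (k - j) * fps_nth g (k - j))
      = c ^ k * (fps_nth f j * fps_nth g (k - j))" if "j \<le> k" for j
  proof -
    have "c ^ k = c ^ j * c ^ (k - j)"
      using that by (simp flip: power_add)
    then show ?thesis by (simp add: ac_simps)
  qed
  then show ?thesis
    by (simp add: fps_mult_nth assms sum_distrib_left)
qed

lemma fps_nth_prod_scaled:
  fixes f f' :: "'b \<Rightarrow> 'a::comm_ring_1 fps"
  assumes "\<And>i k. i \<in> A \<Longrightarrow> fps_nth (f' i) k = c ^ k * fps_nth (f i) k"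
  shows "fps_nth (\<Prod>i\<in>A. f' i) k = c ^ k * fps_nth (\<Prod>i\<in>A. f i) k"
  using assms
proof (induction A arbitrary: k rule: infinite_finite_induct)
  case (insert i A)
  then show ?case
    by (simp add: fps_nth_mult_scaled)
qed (auto simp: power_0_left)

text \<open>Each \<open>H_factor\<close> is the corresponding factor of \<open>E_series\<close> at
  -t, so the product is E(-t).\<close>

lemma fps_nth_prod_H_factor:
  "fps_nth (\<Prod>i=1..n. H_factor s (x i)) k = (- 1) ^ k * modE s n x k"
  unfolding modE_def E_series_def
proof (rule fps_nth_prod_scaled)
  fix i k
  show "fps_nth (H_factor s (x i)) k
      = (- 1) ^ k * fps_nth (\<Sum>j=0..s. (fps_const (x i) * fps_X) ^ j) k"
    unfolding H_factor_eq_geom_sum fps_nth_geom_sum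
    by (simp add: power_minus[of "x i"])
qed

lemma prod_H_factor_mult_H_series: "(\<Prod>i=1..n. H_factor s (x i)) * H_series s n x = 1"
  by (simp add: H_series_def H_factor_inverse flip: prod.distrib)

lemma neg_one_power_pred_mult_c_coeff:
  assumes "k \<ge> 1"
  shows "(- 1) ^ (k - 1) * c_coeff s k = geom_weight s k"
  using assms by (simp add: c_coeff_eq_geom_weight flip: mult.assoc power_add mult_2)

text \<open>The sign (-1)^(k-1) cancels the one in \<open>c_coeff\<close>, leaving the plain
  weight.\<close>

lemma fps_nth_sum_geom_log:
  assumes "k \<ge> 1"
  shows "fps_nth (\<Sum>i=1..n. geom_log s (x i)) k = (- 1) ^ (k - 1) * modP s n x k"
proof -
  have "fps_nth (\<Sum>i=1..n. geom_log s (x i)) k = of_int (geom_weight s k) * power_sum n x k"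
    using assms by (simp add: fps_sum_nth geom_log_def power_sum_def sum_distrib_left)
  also have "of_int (geom_weight s k) = ((- 1) ^ (k - 1) * of_int (c_coeff s k) :: 'a)"
    by (simp flip: neg_one_power_pred_mult_c_coeff[OF assms])
  finally show ?thesis by (simp add: modP_def mult.assoc)
qed

lemma fps_nth_sum_geom_log_uminus:
  assumes "k \<ge> 1"
  shows "fps_nth (\<Sum>i=1..n. geom_log s (- x i)) k = - modP s n x k"
proof -
  have "fps_nth (\<Sum>i=1..n. geom_log s (- x i)) k = (- 1) ^ (k - 1) * modP s n (\<lambda>i. - x i) k"
    by (rule fps_nth_sum_geom_log[OF assms])
  \<comment> \<open>The power sum is homogeneous of degree k.\<close>
  also have "modP s n (\<lambda>i. - x i) k = (- 1) ^ k * modP s n x k"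
    by (simp add: modP_def power_sum_def power_minus[of "x _"] mult.left_commute
        flip: sum_distrib_left)
  also have "(- 1) ^ (k - 1) * ((- 1) ^ k * modP s n x k) = - modP s n x k"
    using assms by (cases k) (simp_all flip: mult.assoc power_add mult_2)
  finally show ?thesis .
qed

lemma fps_nth_sum_geom_log_0: "fps_nth (\<Sum>i\<in>A. geom_log s (x i)) 0 = 0"
  by (simp add: fps_sum_nth geom_log_def)

lemma fps_log_XD_E_series: "fps_log_XD (E_series s n x) (\<Sum>i=1..n. geom_log s (x i))"
  unfolding E_series_def by (intro fps_log_XD_prod fps_log_XD_geom_sum)

lemma fps_log_XD_prod_H_factor:
  "fps_log_XD (\<Prod>i=1..n. H_factor s (x i)) (\<Sum>i=1..n. geom_log s (- x i))"
  unfolding H_factor_eq_geom_sum by (intro fps_log_XD_prod fps_log_XD_geom_sum)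

lemma modE_newton:
  "of_nat k * modE s n x k = (\<Sum>j=1..k. (- 1) ^ (j - 1) * modP s n x j * modE s n x (k - j))"
proof -
  have "of_nat k * modE s n x k
      = (\<Sum>j=1..k. fps_nth (\<Sum>i=1..n. geom_log s (x i)) j * modE s n x (k - j))"
    unfolding modE_def by (rule fps_log_XD_nth[OF fps_log_XD_E_series fps_nth_sum_geom_log_0])
  also have "\<dots> = (\<Sum>j=1..k. (- 1) ^ (j - 1) * modP s n x j * modE s n x (k - j))"
    by (intro sum.cong refl) (simp only: fps_nth_sum_geom_log atLeastAtMost_iff)
  finally show ?thesis .
qed

lemma modH_newton:
  "of_nat k * modH s n x k = (\<Sum>j=1..k. modP s n x j * modH s n x (k - j))"
proof -
  let ?R = "\<Sum>i=1..n. geom_log s (- x i)"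
  \<comment> \<open>\<open>H_series\<close> inverts the product of the \<open>H_factor\<close>s, so
    its logarithmic derivative is \<open>- ?R\<close>. The coefficients of \<open>?R\<close> being
    -P_j, no alternating sign survives.\<close>
  have "of_nat k * modH s n x k = (\<Sum>j=1..k. fps_nth (- ?R) j * modH s n x (k - j))"
    unfolding modH_def
    by (rule fps_log_XD_nth[OF fps_log_XD_inverse[OF fps_log_XD_prod_H_factor
            prod_H_factor_mult_H_series]])
      (simp only: fps_neg_nth fps_nth_sum_geom_log_0 minus_zero)
  also have "\<dots> = (\<Sum>j=1..k. modP s n x j * modH s n x (k - j))"
    by (intro sum.cong refl)
      (simp only: fps_neg_nth fps_nth_sum_geom_log_uminus atLeastAtMost_iff minus_minus)
  finally show ?thesis .
qed

lemma modP_eq_sum_modE_modH: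
  assumes "k \<ge> 1"
  shows "modP s n x k
    = (\<Sum>j=1..k. (- 1) ^ (j - 1) * of_nat j * modE s n x j * modH s n x (k - j))"
proof -
  let ?F = "\<Prod>i=1..n. H_factor s (x i)"
  let ?R = "\<Sum>i=1..n. geom_log s (- x i)"
  \<comment> \<open>Multiplying t F' = R F by H = 1/F isolates R, whose coefficient at k is
    -P_k.\<close>
  have "fps_X * fps_deriv ?F * H_series s n x = ?R * (?F * H_series s n x)"
    using fps_log_XD_prod_H_factor[of s x n] by (simp add: fps_log_XD_def mult.assoc)
  then have "?R = fps_X * fps_deriv ?F * H_series s n x"
    by (simp only: prod_H_factor_mult_H_series mult_1_right)
  then have "modP s n x k = - fps_nth (fps_X * fps_deriv ?F * H_series s n x) k"
    using fps_nth_sum_geom_log_uminus[OF assms, of s x n] by simp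
  also have "\<dots> = - (\<Sum>j=0..k. of_nat j * ((- 1) ^ j * modE s n x j) * modH s n x (k - j))"
    by (simp only: fps_mult_nth[of "fps_X * fps_deriv ?F"] fps_nth_X_mult_deriv
        fps_nth_prod_H_factor modH_def)
  \<comment> \<open>The factor j kills the summand j = 0.\<close>
  also have "\<dots> = (\<Sum>j=1..k. - (of_nat j * ((- 1) ^ j * modE s n x j) * modH s n x (k - j)))"
    by (simp add: sum.atLeast_Suc_atMost sum_negf)
  also have "\<dots> = (\<Sum>j=1..k. (- 1) ^ (j - 1) * of_nat j * modE s n x j * modH s n x (k - j))"
  proof (rule sum.cong)
    fix j assume "j \<in> {1..k}"
    then obtain i where "j = Suc i" by (cases j) auto
    then show "- (of_nat j * ((- 1) ^ j * modE s n x j) * modH s n x (k - j))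
        = (- 1) ^ (j - 1) * of_nat j * modE s n x j * modH s n x (k - j)"
      by (simp add: ac_simps)
  qed simp
  finally show ?thesis .
qed

theorem theorem2p3:
  fixes k n s :: nat
    and x :: "nat \<Rightarrow> 'r::comm_ring_1 mpoly"
  assumes "k \<ge> 1" and "n \<ge> 1" and "s \<ge> 1"
    and x: "\<And>i. i \<in> {1..n} \<Longrightarrow> x i = indet i"
  shows "of_nat k * modE s n x k = (\<Sum>j=1..k. (- 1) ^ (j - 1) * modP s n x j * modE s n x (k - j))
    \<and> of_nat k * modH s n x k = (\<Sum>j=1..k. modP s n x j * modH s n x (k - j))
    \<and> modP s n x k = (\<Sum>j=1..k. (- 1) ^ (j - 1) * of_nat j * modE s n x j * modH s n x (k - j))"
  using modE_newton modH_newton modP_eq_sum_modE_modH[OF \<open>k \<ge> 1\<close>] by blast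

end
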